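(* Let $F$ be the face $(\hat U_{3,5}^{1},\mathcal W_{2}^{23})$ of $\Gamma_4$. For real $a,b\ge 0$, the point $\mathbf h=(a,b)\in F$ is entropic if and only if $a+b=\log v$ for some integer $v\ge 1$.
   Context: $N_4=\{1,2,3,4\}$. $\Gamma_4$ is the cone of all polymatroid rank functions on $N_4$. A set function $\mathbf h:2^{N_4}\to\mathbb R$ is called entropic if there is a random vector $(X_1,X_2,X_3,X_4)$, each $X_i$ taking values in a finite set, with $\mathbf h(A)=H(X_A)$ for all $A\subseteq N_4$, where $H$ is Shannon entropy, $X_A=(X_j,j\in A)$ and $\mathbf h(\emptyset)=0$. Logarithms (also in the entropy) are to base $2$. For two (poly)matroids $M_1,M_2$ on $N_4$ with rank functions $\mathbf r_1,\mathbf r_2$, $(M_1,M_2)$ denotes the face $\{a\mathbf r_1+b\mathbf r_2:a,b\ge0\}$ of $\Gamma_4$, and $(a,b)$ denotes the point $a\mathbf r_1+b\mathbf r_2$. $\hat U^1_{3,5}$ is the integer polymatroid on $N_4$ with rank function $\mathbf r(A)=\min\{3,|A|+1\}$ if $1\in A$ and $\mathbf r(A)=|A|$ if $1\notin A$. $\mathcal W_2^{23}$ is the matroid on $N_4$ with $\mathbf r(\emptyset)=0$, $\mathbf r(A)=1$ if $|A|=1$ or $A=\{2,3\}$, and $\mathbf r(A)=2$ otherwise. *)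

theory Defs
  imports "HOL-Probability.Probability"
begin

section \<open>Set functions and polymatroids on the ground set of four elements\<close>

text \<open>A real function on the subsets of \<open>N4\<close> is represented by a function of type
  \<^typ>\<open>nat set \<Rightarrow> real\<close> of which only the values on subsets of \<open>N4\<close> are relevant.\<close>

definition N4 :: "nat set" where
  "N4 = {1, 2, 3, 4}"

definition polymatroid :: "(nat set \<Rightarrow> real) \<Rightarrow> bool" where
  "polymatroid h \<longleftrightarrow>
     h {} = 0 \<and>
     (\<forall>A B. A \<subseteq> B \<and> B \<subseteq> N4 \<longrightarrow> h A \<le> h B) \<and>
     (\<forall>A B. A \<subseteq> N4 \<and> B \<subseteq> N4 \<longrightarrow> h (A \<union> B) + h (A \<inter> B) \<le> h A + h B)"

definition Gamma4 :: "(nat set \<Rightarrow> real) set" where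
  "Gamma4 = {h. polymatroid h}"

definition face_point ::
    "(nat set \<Rightarrow> real) \<Rightarrow> (nat set \<Rightarrow> real) \<Rightarrow> real \<Rightarrow> real \<Rightarrow> nat set \<Rightarrow> real" where
  "face_point r1 r2 a b = (\<lambda>A. a * r1 A + b * r2 A)"

definition face :: "(nat set \<Rightarrow> real) \<Rightarrow> (nat set \<Rightarrow> real) \<Rightarrow> (nat set \<Rightarrow> real) set" where
  "face r1 r2 = {face_point r1 r2 a b | a b. 0 \<le> a \<and> 0 \<le> b}"

definition hatU35_1 :: "nat set \<Rightarrow> real" where
  "hatU35_1 A = real (if 1 \<in> A then min 3 (card A + 1) else card A)"

definition W2_23 :: "nat set \<Rightarrow> real" where
  "W2_23 A = (if A = {} then 0 else if card A = 1 \<or> A = {2, 3} then 1 else 2)"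

section \<open>Entropic set functions\<close>

definition subvector :: "(nat \<Rightarrow> 'w \<Rightarrow> 'v) \<Rightarrow> nat set \<Rightarrow> 'w \<Rightarrow> nat \<Rightarrow> 'v" where
  "subvector X A = (\<lambda>\<omega>. \<lambda>j\<in>A. X j \<omega>)"

text \<open>Shannon entropy to base 2 of \<open>X\<^sub>A = (X\<^sub>j, j \<in> A)\<close>; for \<open>A = {}\<close> this is the entropy of a
  constant, i.e. 0.\<close>

definition joint_entropy :: "'w measure \<Rightarrow> (nat \<Rightarrow> 'w \<Rightarrow> 'v) \<Rightarrow> nat set \<Rightarrow> real" where
  "joint_entropy M X A =
     prob_space.entropy M 2 (count_space (subvector X A ` space M)) (subvector X A)"

text \<open>Finitely valued random variables are exactly the simple functions. A definition cannot
  quantify over the types of the sample space and of the values, so both are taken to be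
  \<^typ>\<open>nat\<close>; this is no restriction, by \<open>entropicI\<close> below.\<close>

definition entropic :: "(nat set \<Rightarrow> real) \<Rightarrow> bool" where
  "entropic h \<longleftrightarrow>
     (\<exists>(M :: nat measure) (X :: nat \<Rightarrow> nat \<Rightarrow> nat).
        prob_space M \<and> (\<forall>i\<in>N4. simple_function M (X i)) \<and>
        (\<forall>A. A \<subseteq> N4 \<longrightarrow> h A = joint_entropy M X A))"

lemma simple_function_subvector:
  assumes "finite A" "\<And>i. i \<in> A \<Longrightarrow> simple_function M (X i)"
  shows "simple_function M (subvector X A)"
proof -
  have 1: "subvector X A ` space M \<subseteq> PiE A (\<lambda>i. X i ` space M)"
    by (auto simp: subvector_def)
  have fin: "finite (subvector X A ` space M)"
    by (rule finite_subset[OF 1])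
      (auto intro!: finite_PiE assms(1) dest: simple_functionD(1)[OF assms(2)])
  have "subvector X A -` {v} \<inter> space M \<in> sets M" if v: "v \<in> subvector X A ` space M" for v
  proof -
    have "subvector X A -` {v} \<inter> space M = {\<omega> \<in> space M. \<forall>i\<in>A. \<omega> \<in> X i -` {v i} \<inter> space M}"
      using v by (auto simp: subvector_def intro!: restrict_ext) (metis restrict_apply')
    also have "\<dots> \<in> sets M"
    proof (rule sets.sets_Collect_finite_All[OF _ assms(1)])
      fix i assume "i \<in> A"
      moreover have "{\<omega> \<in> space M. \<omega> \<in> X i -` {v i} \<inter> space M} = X i -` {v i} \<inter> space M"
        by auto
      ultimately show "{\<omega> \<in> space M. \<omega> \<in> X i -` {v i} \<inter> space M} \<in> sets M"
        using simple_functionD(2)[OF assms(2)] by simp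
    qed
    finally show ?thesis .
  qed
  then show ?thesis using fin by (auto simp: simple_function_def)
qed

lemma entropy_simple_function:
  assumes "prob_space M" "simple_function M Y"
  shows "prob_space.entropy M 2 (count_space (Y ` space M)) Y =
    - (\<Sum>y\<in>Y ` space M. measure M (Y -` {y} \<inter> space M) * log 2 (measure M (Y -` {y} \<inter> space M)))"
proof -
  interpret prob_space M by fact
  interpret information_space M 2 by standard simp
  show ?thesis
    by (rule entropy_simple_distributed[OF simple_distributedI[OF assms(2)]]) auto
qed

lemma entropicI:
  fixes M :: "'w measure" and X :: "nat \<Rightarrow> 'w \<Rightarrow> 'v"
  assumes M: "prob_space M" and X: "\<And>i. i \<in> N4 \<Longrightarrow> simple_function M (X i)"
    and h: "\<And>A. A \<subseteq> N4 \<Longrightarrow> h A = joint_entropy M X A"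
  shows "entropic h"
proof -
  interpret prob_space M by fact
  define Z where "Z = subvector X N4"
  have Zsimple: "simple_function M Z"
    unfolding Z_def using X by (intro simple_function_subvector) (auto simp: N4_def)
  then have Zfin: "finite (Z ` space M)" by (rule simple_functionD)
  obtain f :: "(nat \<Rightarrow> 'v) \<Rightarrow> nat" where f: "inj_on f (Z ` space M)"
    using finite_imp_inj_to_nat_seg[OF Zfin] by blast
  define V where "V = (\<Union>i\<in>N4. X i ` space M)"
  have "finite V" unfolding V_def using X simple_functionD(1) by (auto simp: N4_def)
  then obtain k :: "'v \<Rightarrow> nat" where k: "inj_on k V"
    using finite_imp_inj_to_nat_seg by blast
  define T where "T = (\<lambda>\<omega>. f (Z \<omega>))"
  define M' where "M' = distr M (count_space (T ` space M)) T"
  define X' where "X' = (\<lambda>i n. k (inv_into (Z ` space M) f n i))"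
  have Tsimple: "simple_function M T"
    using simple_function_compose[OF Zsimple, of f] by (simp add: T_def comp_def)
  have Tm: "T \<in> measurable M (count_space (T ` space M))"
    using Tsimple by (auto simp: measurable_count_space_eq2 simple_function_def)
  have M': "prob_space M'" unfolding M'_def by (rule prob_space_distr[OF Tm])
  have spM': "space M' = T ` space M" and seM': "sets M' = Pow (T ` space M)"
    by (auto simp: M'_def)
  have finT: "finite (T ` space M)" using Tsimple by (rule simple_functionD)
  have simp': "simple_function M' Y" for Y :: "nat \<Rightarrow> 'z"
    using finT by (auto simp: simple_function_def spM' seM')
  have X'T: "X' i (T \<omega>) = k (X i \<omega>)" if "i \<in> N4" "\<omega> \<in> space M" for i \<omega>
    using that f by (simp add: X'_def T_def inv_into_f_f Z_def subvector_def)
  have "joint_entropy M X A = joint_entropy M' X' A" if A: "A \<subseteq> N4" for A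
  proof -
    define Y where "Y = subvector X A"
    define Y' where "Y' = subvector X' A"
    define K where "K = (\<lambda>v. \<lambda>j\<in>A. k (v j))"
    have Ys: "simple_function M Y" unfolding Y_def
      using A X by (intro simple_function_subvector) (auto simp: N4_def finite_subset)
    have Y'T: "Y' (T \<omega>) = K (Y \<omega>)" if "\<omega> \<in> space M" for \<omega>
      using X'T that A by (auto simp: Y'_def Y_def K_def subvector_def fun_eq_iff)
    have Kinj: "inj_on K (Y ` space M)"
    proof (rule inj_onI)
      fix u v assume uv: "u \<in> Y ` space M" "v \<in> Y ` space M" "K u = K v"
      have "u j = v j" for j
      proof (cases "j \<in> A")
        case True
        then have "k (u j) = k (v j)" using fun_cong[OF uv(3), of j] by (simp add: K_def)
        moreover have "u j \<in> V" "v j \<in> V"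
          using True A uv(1,2) by (fastforce simp: V_def Y_def subvector_def)+
        ultimately show ?thesis using k by (simp add: inj_on_eq_iff)
      next
        case False
        then show ?thesis using uv(1,2) by (auto simp: Y_def subvector_def)
      qed
      then show "u = v" by auto
    qed
    have img: "Y' ` space M' = K ` (Y ` space M)"
      using Y'T by (force simp: spM')
    have pr: "measure M' (Y' -` {K y} \<inter> space M') = measure M (Y -` {y} \<inter> space M)"
      if y: "y \<in> Y ` space M" for y
    proof -
      have "measure M' (Y' -` {K y} \<inter> space M') =
          measure M (T -` (Y' -` {K y} \<inter> T ` space M) \<inter> space M)"
        unfolding spM' by (subst M'_def, rule measure_distr[OF Tm]) auto
      also have "T -` (Y' -` {K y} \<inter> T ` space M) \<inter> space M = Y -` {y} \<inter> space M"
      proof (intro set_eqI)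
        fix \<omega>
        show "\<omega> \<in> T -` (Y' -` {K y} \<inter> T ` space M) \<inter> space M \<longleftrightarrow> \<omega> \<in> Y -` {y} \<inter> space M"
          using Y'T[of \<omega>] inj_on_eq_iff[OF Kinj, of "Y \<omega>" y] y by (cases "\<omega> \<in> space M") simp_all
      qed
      finally show ?thesis .
    qed
    show ?thesis
      unfolding joint_entropy_def Y_def[symmetric] Y'_def[symmetric]
      by (subst entropy_simple_function[OF M Ys], subst entropy_simple_function[OF M' simp'])
        (simp add: img sum.reindex[OF Kinj] pr)
  qed
  then show ?thesis
    unfolding entropic_def using M' h by (intro exI[of _ M'] exI[of _ X'] conjI ballI simp') simp_all
qed

section \<open>The face lies in the polymatroid cone\<close>

lemma polymatroid_hatU35_1: "polymatroid hatU35_1"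
  unfolding polymatroid_def
proof (intro conjI allI impI)
  show "hatU35_1 {} = 0" by (simp add: hatU35_1_def)
next
  fix A B assume AB: "A \<subseteq> B \<and> B \<subseteq> N4"
  then have fin: "finite B" by (auto simp: N4_def intro: finite_subset)
  then have "card A \<le> card B" using AB by (auto intro: card_mono)
  moreover have "card A \<le> 3" "card A \<le> card B" if "1 \<notin> A"
  proof -
    have "A \<subseteq> {2, 3, 4}" using that AB by (auto simp: N4_def)
    then have "card A \<le> card {2, 3, 4::nat}" by (intro card_mono) auto
    then show "card A \<le> 3" by simp
  qed fact
  ultimately show "hatU35_1 A \<le> hatU35_1 B" using AB by (auto simp: hatU35_1_def)
next
  fix A B assume AB: "A \<subseteq> N4 \<and> B \<subseteq> N4"
  then have fin: "finite A" "finite B" by (auto simp: N4_def intro: finite_subset)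
  have "card A + card B = card (A \<union> B) + card (A \<inter> B)" by (rule card_Un_Int[OF fin])
  moreover have "card A \<le> card (A \<union> B)" "card B \<le> card (A \<union> B)"
    "card (A \<inter> B) \<le> card A" "card (A \<inter> B) \<le> card B"
    using fin by (auto intro: card_mono)
  ultimately show "hatU35_1 (A \<union> B) + hatU35_1 (A \<inter> B) \<le> hatU35_1 A + hatU35_1 B"
    by (auto simp: hatU35_1_def min_def)
qed

lemma W2_23_eq:
  assumes "A \<subseteq> N4"
  shows "W2_23 A = real (min 2 (card ((\<lambda>i. if i = 3 then 2 else i) ` A)))"
proof -
  have "A = (if 1 \<in> A then {1} else {}) \<union> (if 2 \<in> A then {2} else {}) \<union>
      (if 3 \<in> A then {3} else {}) \<union> (if 4 \<in> A then {4} else {})"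
    using assms by (auto simp: N4_def)
  then consider "A = {}" | "A = {1}" | "A = {2}" | "A = {3}" | "A = {4}"
    | "A = {1, 2}" | "A = {1, 3}" | "A = {1, 4}" | "A = {2, 3}" | "A = {2, 4}" | "A = {3, 4}"
    | "A = {1, 2, 3}" | "A = {1, 2, 4}" | "A = {1, 3, 4}" | "A = {2, 3, 4}" | "A = {1, 2, 3, 4}"
    by (cases "1 \<in> A"; cases "2 \<in> A"; cases "3 \<in> A"; cases "4 \<in> A")
      (simp_all only: if_True if_False Un_empty_left Un_empty_right Un_insert_left)
  then show ?thesis
    by cases (simp_all add: W2_23_def doubleton_eq_iff insert_eq_iff card_insert_if)
qed

lemma polymatroid_W2_23: "polymatroid W2_23"
  unfolding polymatroid_def
proof (intro conjI allI impI)
  show "W2_23 {} = 0" by (simp add: W2_23_def)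
next
  let ?f = "\<lambda>i::nat. if i = 3 then 2 else i"
  fix A B assume AB: "A \<subseteq> B \<and> B \<subseteq> N4"
  then have "finite B" by (auto simp: N4_def intro: finite_subset)
  then have "card (?f ` A) \<le> card (?f ` B)" using AB by (intro card_mono) auto
  moreover have "A \<subseteq> N4" using AB by auto
  ultimately show "W2_23 A \<le> W2_23 B" using AB by (simp add: W2_23_eq min_def)
next
  let ?f = "\<lambda>i::nat. if i = 3 then 2 else i"
  fix A B assume AB: "A \<subseteq> N4 \<and> B \<subseteq> N4"
  then have fin: "finite (?f ` A)" "finite (?f ` B)" by (auto simp: N4_def intro: finite_subset)
  define u where "u = card (?f ` A \<union> ?f ` B)"
  define n where "n = card (?f ` A \<inter> ?f ` B)"
  define x where "x = card (?f ` A)"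
  define y where "y = card (?f ` B)"
  define z where "z = card (?f ` (A \<inter> B))"
  have s: "x + y = u + n" unfolding x_def y_def u_def n_def by (rule card_Un_Int[OF fin])
  have l: "x \<le> u" "y \<le> u" "n \<le> x" "n \<le> y"
    unfolding x_def y_def u_def n_def using fin by (auto intro!: card_mono)
  have m: "z \<le> n"
    unfolding z_def n_def using fin by (intro card_mono) auto
  have "min 2 u + min 2 z \<le> min 2 x + min 2 y"
    using s l m by (auto simp: min_def)
  then have "real (min 2 u) + real (min 2 z) \<le> real (min 2 x) + real (min 2 y)"
    by (simp only: of_nat_add[symmetric] of_nat_le_iff)
  moreover have "A \<union> B \<subseteq> N4" "A \<inter> B \<subseteq> N4" using AB by auto
  ultimately show "W2_23 (A \<union> B) + W2_23 (A \<inter> B) \<le> W2_23 A + W2_23 B"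
    using AB by (simp only: W2_23_eq x_def y_def z_def u_def image_Un)
qed

lemma face_subset_Gamma4: "face hatU35_1 W2_23 \<subseteq> Gamma4"
proof -
  have "polymatroid (face_point r1 r2 a b)"
    if "polymatroid r1" "polymatroid r2" "0 \<le> a" "0 \<le> b" for r1 r2 a b
    unfolding polymatroid_def face_point_def
  proof (intro conjI allI impI)
    show "a * r1 {} + b * r2 {} = 0" using that by (simp add: polymatroid_def)
  next
    fix A B assume "A \<subseteq> B \<and> B \<subseteq> N4"
    then show "a * r1 A + b * r2 A \<le> a * r1 B + b * r2 B"
      using that by (intro add_mono mult_left_mono) (auto simp: polymatroid_def)
  next
    fix A B assume "A \<subseteq> N4 \<and> B \<subseteq> N4"
    then have "a * (r1 (A \<union> B) + r1 (A \<inter> B)) + b * (r2 (A \<union> B) + r2 (A \<inter> B))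
        \<le> a * (r1 A + r1 B) + b * (r2 A + r2 B)"
      using that
      by (intro add_mono[of "a * _" "a * _" "b * _" "b * _"] mult_left_mono)
        (auto simp: polymatroid_def)
    then show "a * r1 (A \<union> B) + b * r2 (A \<union> B) + (a * r1 (A \<inter> B) + b * r2 (A \<inter> B))
        \<le> a * r1 A + b * r2 A + (a * r1 B + b * r2 B)"
      by (simp add: algebra_simps)
  qed
  then show ?thesis
    using polymatroid_hatU35_1 polymatroid_W2_23 by (auto simp: face_def Gamma4_def)
qed

end

theory Submission
  imports Defs "HOL-Number_Theory.Cong" "HOL-Real_Asymp.Real_Asymp"
begin

text \<open>If \<open>(a, b)\<close> is the entropy function of \<open>(X\<^sub>1, \<dots>, X\<^sub>4)\<close>, then \<open>X\<^sub>1\<close>, \<open>X\<^sub>2\<close>, \<open>X\<^sub>4\<close> are pairwise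
  independent, and \<open>X\<^sub>1\<close> together with either of \<open>X\<^sub>2\<close>, \<open>X\<^sub>4\<close> determines the other. For \<open>y\<close>, \<open>z\<close> in the
  supports of \<open>X\<^sub>2\<close>, \<open>X\<^sub>4\<close> some \<open>x\<close> makes \<open>(x, y, z)\<close> possible, and its probability is both
  \<open>P(x) P(y)\<close> and \<open>P(x) P(z)\<close>. So \<open>P(y) = P(z)\<close> always, hence \<open>X\<^sub>2\<close> is uniform and its entropy \<open>a + b\<close>
  is the logarithm of an integer.

  Conversely, for \<open>a + b = log v\<close> take independent \<open>C\<close>, \<open>U\<close>, \<open>D\<close> modulo \<open>v\<close> with \<open>U\<close>, \<open>D\<close> uniform and
  \<open>H(C) = a\<close>, and put \<open>X\<^sub>1 = (C, D)\<close>, \<open>X\<^sub>2 = U\<close>, \<open>X\<^sub>3 = U + C\<close>, \<open>X\<^sub>4 = U + D\<close>.\<close>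

section \<open>Entropy as a finite sum\<close>

text \<open>Unlike \<open>joint_entropy\<close>, this applies to tuples of any value type. Image
  values of probability 0 contribute 0.\<close>

definition entropy2 :: "'w measure \<Rightarrow> ('w \<Rightarrow> 'v) \<Rightarrow> real" where
  "entropy2 M Y = - (\<Sum>y\<in>Y ` space M. measure M (Y -` {y} \<inter> space M) * log 2 (measure M (Y -` {y} \<inter> space M)))"

text \<open>Entropy depends only on the partition of the sample space into fibres, so a subvector
  may be replaced by a tuple.\<close>

lemma entropy2_cong:
  assumes "\<And>\<omega> \<omega>'. \<omega> \<in> space M \<Longrightarrow> \<omega>' \<in> space M \<Longrightarrow> Y \<omega> = Y \<omega>' \<longleftrightarrow> Z \<omega> = Z \<omega>'"
  shows "entropy2 M Y = entropy2 M Z"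
proof -
  define g where "g = (\<lambda>y. Z (inv_into (space M) Y y))"
  have g: "g (Y \<omega>) = Z \<omega>" if "\<omega> \<in> space M" for \<omega>
    unfolding g_def using assms[of "inv_into (space M) Y (Y \<omega>)" \<omega>] that
    by (simp add: inv_into_into f_inv_into_f)
  have inj: "inj_on g (Y ` space M)"
    using assms g by (auto simp: inj_on_def)
  have img: "Z ` space M = g ` (Y ` space M)"
    using g by force
  have pre: "Z -` {g y} \<inter> space M = Y -` {y} \<inter> space M" if "y \<in> Y ` space M" for y
    using that g assms by auto
  show ?thesis
    unfolding entropy2_def img by (simp add: sum.reindex[OF inj] pre)
qed

lemma joint_entropy_eq_entropy2:
  assumes "prob_space M" "finite A" "\<And>i. i \<in> A \<Longrightarrow> simple_function M (X i)"
  shows "joint_entropy M X A = entropy2 M (subvector X A)"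
  unfolding joint_entropy_def entropy2_def
  by (rule entropy_simple_function[OF assms(1) simple_function_subvector[OF assms(2,3)]])

lemma subvector_eq_iff: "subvector X A \<omega> = subvector X A \<omega>' \<longleftrightarrow> (\<forall>j\<in>A. X j \<omega> = X j \<omega>')"
  by (auto simp: subvector_def fun_eq_iff restrict_def)

section \<open>Analysis of \<open>x log x\<close> and Gibbs' inequality\<close>

text \<open>Serves the intermediate value argument below, where weights reach 0: there the limit
  from the right is 0, matching \<open>0 * log 2 0 = 0\<close>.\<close>

lemma continuous_on_mult_log: "continuous_on {0..} (\<lambda>x::real. x * log 2 x)"
proof -
  have "continuous (at x within {0..}) (\<lambda>x::real. x * log 2 x)" if "x \<ge> 0" for x
  proof (cases "x = 0")
    case True
    have "((\<lambda>x::real. x * log 2 x) \<longlongrightarrow> 0) (at_right 0)"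
      unfolding log_def by real_asymp
    then show ?thesis
      unfolding True continuous_within by (simp add: at_within_Ici_at_right)
  next
    case False
    then show ?thesis using that by (intro continuous_intros) auto
  qed
  then show ?thesis by (simp add: continuous_on_eq_continuous_within)
qed

text \<open>The summands of \<open>\<Sum> p ln (p / q) - p + q\<close> are nonnegative; stating this termwise makes the
  equality case of Gibbs' inequality immediate, including where \<open>p = 0\<close>.\<close>

lemma kl_divergence_term:
  fixes p q :: real
  assumes "0 \<le> p" "0 \<le> q" "q = 0 \<Longrightarrow> p = 0"
  shows "p - q \<le> p * ln p - p * ln q" "p * ln p - p * ln q = p - q \<Longrightarrow> p = q"
proof -
  have *: "p - q \<le> p * ln p - p * ln q \<and> (p * ln p - p * ln q = p - q \<longrightarrow> p = q)"
  proof (cases "p = 0")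
    case False
    then have pos: "p > 0" "q > 0" using assms by fastforce+
    \<comment> \<open>Both claims reduce to \<open>ln x \<le> x - 1\<close> at
      \<open>x = q / p\<close>, with equality only at \<open>x = 1\<close>.\<close>
    have eq: "p * ln p - p * ln q = - (p * ln (q / p))" and r: "p - q = - (p * (q / p - 1))"
      using pos by (simp_all add: ln_div algebra_simps)
    have "ln (q / p) \<le> q / p - 1" using pos by (intro ln_le_minus_one) simp
    moreover have "q / p = 1" if "ln (q / p) = q / p - 1"
      using ln_eq_minus_one[OF _ that] pos by simp
    ultimately show ?thesis unfolding eq r using pos by auto
  qed (use assms in auto)
  show "p - q \<le> p * ln p - p * ln q" "p * ln p - p * ln q = p - q \<Longrightarrow> p = q"
    using * by auto
qed

section \<open>Functional dependence and independence from equalities of entropies\<close>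

context prob_space
begin

lemma marginal_prob:
  assumes "simple_function M Y" "simple_function M Z"
  shows "prob (Y -` {y} \<inter> space M) =
    (\<Sum>z\<in>Z ` space M. prob ((\<lambda>\<omega>. (Y \<omega>, Z \<omega>)) -` {(y, z)} \<inter> space M))"
proof -
  have s: "simple_function M (\<lambda>\<omega>. (Y \<omega>, Z \<omega>))"
    using assms by (rule simple_function_Pair)
  have "Y -` {y} \<inter> space M = (\<Union>z\<in>Z ` space M. (\<lambda>\<omega>. (Y \<omega>, Z \<omega>)) -` {(y, z)} \<inter> space M)"
    by auto
  then have "prob (Y -` {y} \<inter> space M) =
      prob (\<Union>z\<in>Z ` space M. (\<lambda>\<omega>. (Y \<omega>, Z \<omega>)) -` {(y, z)} \<inter> space M)"
    by (rule arg_cong)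
  also have "\<dots> = (\<Sum>z\<in>Z ` space M. prob ((\<lambda>\<omega>. (Y \<omega>, Z \<omega>)) -` {(y, z)} \<inter> space M))"
    using simple_functionD(1)[OF assms(2)] simple_functionD(2)[OF s]
    by (intro finite_measure_finite_Union) (auto simp: disjoint_family_on_def)
  finally show ?thesis .
qed

text \<open>Summing over the full product of images, where impossible pairs contribute 0, gives
  joint and marginal entropies a common index set.\<close>

lemma entropy2_Pair_eq:
  assumes "simple_function M Y" "simple_function M Z"
  defines "p \<equiv> \<lambda>y z. prob ((\<lambda>\<omega>. (Y \<omega>, Z \<omega>)) -` {(y, z)} \<inter> space M)"
  shows "entropy2 M (\<lambda>\<omega>. (Y \<omega>, Z \<omega>)) =
    - (\<Sum>(y, z)\<in>Y ` space M \<times> Z ` space M. p y z * log 2 (p y z))"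
proof -
  have "p y z = 0" if "(y, z) \<notin> (\<lambda>\<omega>. (Y \<omega>, Z \<omega>)) ` space M" for y z
  proof -
    have "(\<lambda>\<omega>. (Y \<omega>, Z \<omega>)) -` {(y, z)} \<inter> space M = {}" using that by auto
    then show ?thesis by (simp only: p_def measure_empty)
  qed
  then show ?thesis
    unfolding entropy2_def p_def using assms(1,2)
    by (intro arg_cong[where f = uminus] sum.mono_neutral_cong_left)
      (auto dest: simple_functionD(1))
qed

text \<open>The marginal entropy becomes an expectation under the joint law, so that differences of
  entropies can be examined term by term.\<close>

lemma entropy2_fst_eq:
  assumes "simple_function M Y" "simple_function M Z"
  shows "entropy2 M Y = - (\<Sum>(y, z)\<in>Y ` space M \<times> Z ` space M.
    prob ((\<lambda>\<omega>. (Y \<omega>, Z \<omega>)) -` {(y, z)} \<inter> space M) * log 2 (prob (Y -` {y} \<inter> space M)))"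
  unfolding entropy2_def sum.cartesian_product[symmetric] sum_distrib_right[symmetric]
  by (simp add: marginal_prob[OF assms])

lemma prob_Pair_swap:
  "prob ((\<lambda>\<omega>. (Y \<omega>, Z \<omega>)) -` {(y, z)} \<inter> space M) =
   prob ((\<lambda>\<omega>. (Z \<omega>, Y \<omega>)) -` {(z, y)} \<inter> space M)"
  by (rule arg_cong[where f = prob]) auto

lemma entropy2_snd_eq:
  assumes "simple_function M Y" "simple_function M Z"
  shows "entropy2 M Z = - (\<Sum>(y, z)\<in>Y ` space M \<times> Z ` space M.
    prob ((\<lambda>\<omega>. (Y \<omega>, Z \<omega>)) -` {(y, z)} \<inter> space M) * log 2 (prob (Z -` {z} \<inter> space M)))"
  unfolding entropy2_fst_eq[OF assms(2,1)] sum.cartesian_product[symmetric]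
  by (subst sum.swap) (simp add: prob_Pair_swap[of Z Y])

lemma prob_Pair_le:
  assumes "simple_function M Y"
  shows "prob ((\<lambda>\<omega>. (Y \<omega>, Z \<omega>)) -` {(y, z)} \<inter> space M) \<le> prob (Y -` {y} \<inter> space M)"
  by (rule finite_measure_mono) (use simple_functionD(2)[OF assms] in auto)

lemma sum_prob_simple_function:
  assumes "simple_function M Y"
  shows "(\<Sum>y\<in>Y ` space M. prob (Y -` {y} \<inter> space M)) = 1"
proof -
  have "(\<Union>y\<in>Y ` space M. Y -` {y} \<inter> space M) = space M" by auto
  then have "1 = prob (\<Union>y\<in>Y ` space M. Y -` {y} \<inter> space M)" by (simp add: prob_space)
  also have "\<dots> = (\<Sum>y\<in>Y ` space M. prob (Y -` {y} \<inter> space M))"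
    using simple_functionD[OF assms]
    by (intro finite_measure_finite_Union) (auto simp: disjoint_family_on_def)
  finally show ?thesis by simp
qed

text \<open>The conditional entropy of \<open>Z\<close> given \<open>Y\<close> is the sum of the
  terms \<open>?t\<close>, each nonnegative because a joint probability is at most its marginal. A
  zero sum makes every term vanish, and injectivity of the logarithm finishes.\<close>

lemma functional_if_entropy2_Pair_eq:
  assumes Y: "simple_function M Y" and Z: "simple_function M Z"
    and eq: "entropy2 M (\<lambda>\<omega>. (Y \<omega>, Z \<omega>)) = entropy2 M Y"
    and pos: "prob ((\<lambda>\<omega>. (Y \<omega>, Z \<omega>)) -` {(y, z)} \<inter> space M) > 0"
  shows "prob ((\<lambda>\<omega>. (Y \<omega>, Z \<omega>)) -` {(y, z)} \<inter> space M) = prob (Y -` {y} \<inter> space M)"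
proof -
  define p where "p = (\<lambda>y z. prob ((\<lambda>\<omega>. (Y \<omega>, Z \<omega>)) -` {(y, z)} \<inter> space M))"
  define r where "r = (\<lambda>y. prob (Y -` {y} \<inter> space M))"
  let ?S = "Y ` space M \<times> Z ` space M"
  let ?t = "\<lambda>(y, z). p y z * log 2 (r y) - p y z * log 2 (p y z)"
  have le: "p y z \<le> r y" and nn: "0 \<le> p y z" for y z
    unfolding p_def r_def using prob_Pair_le[OF Y] by auto
  have t: "?t s \<ge> 0" for s
    using le[of "fst s" "snd s"] nn[of "fst s" "snd s"]
    by (cases "p (fst s) (snd s) = 0") (auto simp: case_prod_beta intro!: mult_left_mono)
  have fin: "finite ?S" using Y Z by (auto dest: simple_functionD(1))
  have "sum ?t ?S = 0"
    using eq unfolding entropy2_Pair_eq[OF Y Z] entropy2_fst_eq[OF Y Z]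
    by (simp add: p_def r_def case_prod_beta sum_subtractf)
  moreover have "(y, z) \<in> ?S"
  proof (rule ccontr)
    assume "(y, z) \<notin> ?S"
    then have "(\<lambda>\<omega>. (Y \<omega>, Z \<omega>)) -` {(y, z)} \<inter> space M = {}" by auto
    then show False using pos by (simp only: measure_empty)
  qed
  ultimately have "?t (y, z) = 0"
    using sum_nonneg_eq_0_iff[of ?S ?t, OF fin t] by blast
  moreover have "p y z > 0" using pos by (simp add: p_def)
  ultimately have "p y z = r y"
    using le[of y z] inj_onD[OF log_inj[of 2], of "p y z" "r y"] by auto
  then show ?thesis by (simp add: p_def r_def)
qed

text \<open>The mutual information of \<open>Y\<close> and \<open>Z\<close> is the divergence of
  their joint law from the product of the marginals; its vanishing is the equality case of Gibbs'
  inequality.\<close>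

lemma indep_if_entropy2_Pair_eq:
  assumes Y: "simple_function M Y" and Z: "simple_function M Z"
    and eq: "entropy2 M (\<lambda>\<omega>. (Y \<omega>, Z \<omega>)) = entropy2 M Y + entropy2 M Z"
    and y: "y \<in> Y ` space M" and z: "z \<in> Z ` space M"
  shows "prob ((\<lambda>\<omega>. (Y \<omega>, Z \<omega>)) -` {(y, z)} \<inter> space M) =
    prob (Y -` {y} \<inter> space M) * prob (Z -` {z} \<inter> space M)"
proof -
  define p where "p = (\<lambda>y z. prob ((\<lambda>\<omega>. (Y \<omega>, Z \<omega>)) -` {(y, z)} \<inter> space M))"
  define r where "r = (\<lambda>y. prob (Y -` {y} \<inter> space M))"
  define s where "s = (\<lambda>z. prob (Z -` {z} \<inter> space M))"
  let ?S = "Y ` space M \<times> Z ` space M"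
  \<comment> \<open>The correction \<open>p y z - r y * s z\<close> makes each term nonnegative and
    sums to 0, since both laws have total mass 1.\<close>
  let ?t = "\<lambda>(y, z). p y z * ln (p y z) - p y z * ln (r y * s z) - (p y z - r y * s z)"
  have le: "p y z \<le> r y" "p y z \<le> s z" and nn: "0 \<le> p y z" "0 \<le> r y" "0 \<le> s z" for y z
    unfolding p_def r_def s_def
    using prob_Pair_le[OF Y, where Z = Z and y = y and z = z]
      prob_Pair_le[OF Z, where Z = Y and y = z and z = y]
    by (simp_all only: prob_Pair_swap[where Y = Z and Z = Y and y = z and z = y] measure_nonneg)
  have ac: "p y z = 0" if "r y * s z = 0" for y z
    using that le[of y z] nn(1)[of y z] by auto
  have t: "?t x \<ge> 0" for x
    using kl_divergence_term(1)[of "p (fst x) (snd x)" "r (fst x) * s (snd x)"] nn ac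
    by (simp add: case_prod_beta)
  have fin: "finite ?S" using Y Z by (auto dest: simple_functionD(1))
  have log: "p y z * ln (p y z) - p y z * ln (r y * s z) =
      ln 2 * (p y z * log 2 (p y z) - p y z * log 2 (r y) - p y z * log 2 (s z))" for y z
  proof (cases "p y z = 0")
    case False
    then have "r y > 0" "s z > 0" using le[of y z] nn(1)[of y z] by auto
    then show ?thesis by (simp add: log_def ln_mult field_simps)
  qed simp
  have "(\<Sum>(y, z)\<in>?S. p y z * log 2 (p y z) - p y z * log 2 (r y) - p y z * log 2 (s z)) = 0"
    using eq unfolding entropy2_Pair_eq[OF Y Z] entropy2_fst_eq[OF Y Z] entropy2_snd_eq[OF Y Z]
    by (simp add: p_def r_def s_def case_prod_beta sum_subtractf)
  moreover have "(\<Sum>(y, z)\<in>?S. p y z) = 1"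
    unfolding p_def sum.cartesian_product[symmetric] marginal_prob[OF Y Z, symmetric]
    by (rule sum_prob_simple_function[OF Y])
  moreover have "(\<Sum>(y, z)\<in>?S. r y * s z) = 1"
    using sum_prob_simple_function[OF Y] sum_prob_simple_function[OF Z]
    by (simp add: r_def s_def sum.cartesian_product[symmetric] sum_distrib_left[symmetric]
      sum_distrib_right[symmetric])
  ultimately have "sum ?t ?S = 0"
    by (simp add: log case_prod_beta sum_subtractf sum_distrib_left[symmetric])
  then have "?t (y, z) = 0"
    using sum_nonneg_eq_0_iff[of ?S ?t, OF fin t] y z by blast
  then have "p y z = r y * s z"
    using kl_divergence_term(2)[of "p y z" "r y * s z"] nn ac by simp
  then show ?thesis by (simp add: p_def r_def s_def)
qed

end

section \<open>Necessity: an entropic point gives \<open>a + b = log v\<close>\<close>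

lemma (in prob_space) prob_pos_in_image:
  assumes "prob (Y -` {y} \<inter> space M) > 0"
  shows "y \<in> Y ` space M"
proof (rule ccontr)
  assume "y \<notin> Y ` space M"
  then have "Y -` {y} \<inter> space M = {}" by auto
  then show False using assms by (simp only: measure_empty)
qed

text \<open>\<open>v\<close> is the size of the support \<open>S\<close>: equal masses adding up to
  1 force \<open>c = 1 / card S\<close>. Image values of probability 0 lie outside
  \<open>S\<close>.\<close>

lemma (in prob_space) uniform_if_equiprobable:
  assumes Y: "simple_function M Y"
    and c: "\<And>y. prob (Y -` {y} \<inter> space M) > 0 \<Longrightarrow> prob (Y -` {y} \<inter> space M) = c"
  shows "\<exists>v::nat. 1 \<le> v \<and> entropy2 M Y = log 2 (real v)"
proof -
  define p where "p = (\<lambda>y. prob (Y -` {y} \<inter> space M))"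
  define S where "S = {y \<in> Y ` space M. p y > 0}"
  have fin: "finite (Y ` space M)" using Y by (rule simple_functionD)
  have zero: "p y = 0" if "y \<in> Y ` space M - S" for y
    using that measure_nonneg[of M "Y -` {y} \<inter> space M"] by (auto simp: S_def p_def)
  have "1 = (\<Sum>y\<in>S. p y)"
    using sum_prob_simple_function[OF Y] fin zero
    by (subst sum.mono_neutral_left[of "Y ` space M" S p]) (auto simp: S_def p_def)
  also have "\<dots> = (\<Sum>y\<in>S. c)"
    using c by (intro sum.cong) (auto simp: S_def p_def)
  finally have "real (card S) * c = 1" by simp
  then have "card S \<noteq> 0" by (metis mult_zero_left of_nat_0 zero_neq_one)
  with \<open>real (card S) * c = 1\<close> have ceq: "c = 1 / real (card S)"
    by (simp add: nonzero_eq_divide_eq mult.commute)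
  have "entropy2 M Y = - (\<Sum>y\<in>Y ` space M. p y * log 2 (p y))"
    by (simp add: entropy2_def p_def)
  also have "(\<Sum>y\<in>Y ` space M. p y * log 2 (p y)) = (\<Sum>y\<in>S. p y * log 2 (p y))"
    using fin zero by (intro sum.mono_neutral_right) (auto simp: S_def)
  also have "(\<Sum>y\<in>S. p y * log 2 (p y)) = (\<Sum>y\<in>S. c * log 2 c)"
    using c by (intro sum.cong) (auto simp: S_def p_def)
  also have "- \<dots> = log 2 (real (card S))"
    using \<open>card S \<noteq> 0\<close> by (simp add: ceq log_divide)
  finally show ?thesis using \<open>card S \<noteq> 0\<close> by (intro exI[of _ "card S"]) auto
qed

lemma face_point_values:
  fixes a b :: real
  defines "h \<equiv> face_point hatU35_1 W2_23 a b"
  shows "h {} = 0" "h {1} = 2 * a + b" "h {2} = a + b" "h {3} = a + b" "h {4} = a + b"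
    "h {1, 2} = 3 * a + 2 * b" "h {1, 3} = 3 * a + 2 * b" "h {1, 4} = 3 * a + 2 * b"
    "h {2, 3} = 2 * a + b" "h {2, 4} = 2 * a + 2 * b" "h {3, 4} = 2 * a + 2 * b"
    "h {1, 2, 3} = 3 * a + 2 * b" "h {1, 2, 4} = 3 * a + 2 * b" "h {1, 3, 4} = 3 * a + 2 * b"
    "h {2, 3, 4} = 3 * a + 2 * b" "h {1, 2, 3, 4} = 3 * a + 2 * b"
  by (simp_all add: h_def face_point_def hatU35_1_def W2_23_def doubleton_eq_iff insert_eq_iff)

lemma log_if_entropic:
  assumes "entropic (face_point hatU35_1 W2_23 a b)"
  shows "\<exists>v::nat. 1 \<le> v \<and> a + b = log 2 (real v)"
proof -
  let ?h = "face_point hatU35_1 W2_23 a b"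
  obtain M :: "nat measure" and X :: "nat \<Rightarrow> nat \<Rightarrow> nat" where
    "prob_space M" and X: "\<And>i. i \<in> N4 \<Longrightarrow> simple_function M (X i)"
    and h: "\<And>A. A \<subseteq> N4 \<Longrightarrow> ?h A = joint_entropy M X A"
    using assms unfolding entropic_def by blast
  interpret prob_space M by fact
  \<comment> \<open>Passes from index sets to tuples with the same fibres, whose nesting can then
    suit the entropy lemmas.\<close>
  have hent: "?h A = entropy2 M Z"
    if "A \<subseteq> N4" "\<And>\<omega> \<omega>'. (\<forall>j\<in>A. X j \<omega> = X j \<omega>') \<longleftrightarrow> Z \<omega> = Z \<omega>'"
    for A and Z :: "nat \<Rightarrow> 'z"
  proof -
    have "finite A" using that(1) by (auto simp: N4_def finite_subset)
    then have "?h A = entropy2 M (subvector X A)"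
      using h[OF that(1)] X that(1) joint_entropy_eq_entropy2[OF \<open>prob_space M\<close>, of A X] by auto
    also have "\<dots> = entropy2 M Z" by (rule entropy2_cong) (simp add: subvector_eq_iff that(2))
    finally show ?thesis .
  qed
  have s1: "simple_function M (X 1)" and s2: "simple_function M (X 2)"
    and s4: "simple_function M (X 4)"
    using X by (auto simp: N4_def)
  have e1: "entropy2 M (X 1) = 2 * a + b" and e2: "entropy2 M (X 2) = a + b" and e4: "entropy2 M (X 4) = a + b"
    using hent[of "{1}" "X 1"] hent[of "{2}" "X 2"] hent[of "{4}" "X 4"]
    by (simp_all add: N4_def face_point_values del: One_nat_def)
  \<comment> \<open>Each value is the sum of the two single entropies, which expresses pairwise
    independence.\<close>
  have e12: "entropy2 M (\<lambda>\<omega>. (X 1 \<omega>, X 2 \<omega>)) = 3 * a + 2 * b"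
    and e14: "entropy2 M (\<lambda>\<omega>. (X 1 \<omega>, X 4 \<omega>)) = 3 * a + 2 * b"
    and e24: "entropy2 M (\<lambda>\<omega>. (X 2 \<omega>, X 4 \<omega>)) = 2 * a + 2 * b"
    using hent[of "{1, 2}" "\<lambda>\<omega>. (X 1 \<omega>, X 2 \<omega>)"] hent[of "{1, 4}" "\<lambda>\<omega>. (X 1 \<omega>, X 4 \<omega>)"]
      hent[of "{2, 4}" "\<lambda>\<omega>. (X 2 \<omega>, X 4 \<omega>)"]
    by (simp_all add: N4_def face_point_values del: One_nat_def)
  \<comment> \<open>The same value as for \<open>(X 1, X 2)\<close> and \<open>(X 1, X 4)\<close>:
    the remaining variable is almost surely a function of either pair.\<close>
  have e124: "entropy2 M (\<lambda>\<omega>. ((X 1 \<omega>, X 2 \<omega>), X 4 \<omega>)) = 3 * a + 2 * b"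
    and e142: "entropy2 M (\<lambda>\<omega>. ((X 1 \<omega>, X 4 \<omega>), X 2 \<omega>)) = 3 * a + 2 * b"
    using hent[of "{1, 2, 4}" "\<lambda>\<omega>. ((X 1 \<omega>, X 2 \<omega>), X 4 \<omega>)"]
      hent[of "{1, 2, 4}" "\<lambda>\<omega>. ((X 1 \<omega>, X 4 \<omega>), X 2 \<omega>)"]
    by (simp_all add: N4_def face_point_values conj_ac del: One_nat_def)
  define p2 where "p2 = (\<lambda>y. prob (X 2 -` {y} \<inter> space M))"
  define p4 where "p4 = (\<lambda>z. prob (X 4 -` {z} \<inter> space M))"
  have same: "p2 y = p4 z" if pos: "p2 y > 0" "p4 z > 0" for y z
  proof -
    have img: "y \<in> X 2 ` space M" "z \<in> X 4 ` space M"
      using pos prob_pos_in_image by (auto simp: p2_def p4_def)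
    have "prob ((\<lambda>\<omega>. (X 2 \<omega>, X 4 \<omega>)) -` {(y, z)} \<inter> space M) = p2 y * p4 z"
      unfolding p2_def p4_def by (rule indep_if_entropy2_Pair_eq[OF s2 s4 _ img]) (simp add: e24 e2 e4)
    then have "(\<Sum>x\<in>X 1 ` space M.
        prob ((\<lambda>\<omega>. ((X 2 \<omega>, X 4 \<omega>), X 1 \<omega>)) -` {((y, z), x)} \<inter> space M)) > 0"
      using pos marginal_prob[OF simple_function_Pair[OF s2 s4] s1, of "(y, z)"] by simp
    then obtain x where x: "x \<in> X 1 ` space M"
      and posx: "prob ((\<lambda>\<omega>. ((X 2 \<omega>, X 4 \<omega>), X 1 \<omega>)) -` {((y, z), x)} \<inter> space M) > 0"
      by (meson not_le sum_nonpos)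
    let ?q = "prob {\<omega> \<in> space M. X 1 \<omega> = x \<and> X 2 \<omega> = y \<and> X 4 \<omega> = z}"
    have q: "prob ((\<lambda>\<omega>. ((X 2 \<omega>, X 4 \<omega>), X 1 \<omega>)) -` {((y, z), x)} \<inter> space M) = ?q"
      "prob ((\<lambda>\<omega>. ((X 1 \<omega>, X 2 \<omega>), X 4 \<omega>)) -` {((x, y), z)} \<inter> space M) = ?q"
      "prob ((\<lambda>\<omega>. ((X 1 \<omega>, X 4 \<omega>), X 2 \<omega>)) -` {((x, z), y)} \<inter> space M) = ?q"
      by (auto intro!: arg_cong[where f = prob])
    have qpos: "?q > 0" using posx q(1) by simp
    have "?q = prob ((\<lambda>\<omega>. (X 1 \<omega>, X 2 \<omega>)) -` {(x, y)} \<inter> space M)"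
      unfolding q(2)[symmetric]
      by (rule functional_if_entropy2_Pair_eq[OF simple_function_Pair[OF s1 s2] s4])
        (use e124 e12 qpos q(2) in simp_all)
    also have "\<dots> = prob (X 1 -` {x} \<inter> space M) * p2 y"
      unfolding p2_def by (rule indep_if_entropy2_Pair_eq[OF s1 s2 _ x img(1)]) (simp add: e12 e1 e2 del: One_nat_def)
    finally have q2: "?q = prob (X 1 -` {x} \<inter> space M) * p2 y" .
    have "?q = prob ((\<lambda>\<omega>. (X 1 \<omega>, X 4 \<omega>)) -` {(x, z)} \<inter> space M)"
      unfolding q(3)[symmetric]
      by (rule functional_if_entropy2_Pair_eq[OF simple_function_Pair[OF s1 s4] s2])
        (use e142 e14 qpos q(3) in simp_all)
    also have "\<dots> = prob (X 1 -` {x} \<inter> space M) * p4 z"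
      unfolding p4_def by (rule indep_if_entropy2_Pair_eq[OF s1 s4 _ x img(2)]) (simp add: e14 e1 e4 del: One_nat_def)
    \<comment> \<open>\<open>?q > 0\<close> makes the probability of \<open>x\<close> nonzero, so it
      cancels.\<close>
    finally show ?thesis using q2 qpos by auto
  qed
  \<comment> \<open>One support point of \<open>X 4\<close> fixes the common mass for all support
    points of \<open>X 2\<close>.\<close>
  obtain z where z: "p4 z > 0"
  proof -
    have "(\<Sum>z\<in>X 4 ` space M. p4 z) > 0"
      using sum_prob_simple_function[OF s4] by (simp add: p4_def)
    then show ?thesis using that by (meson not_le sum_nonpos)
  qed
  show ?thesis
    using uniform_if_equiprobable[OF s2, of "p4 z"] same z e2 by (simp add: p2_def)
qed

section \<open>Sufficiency: cyclic construction for \<open>a + b = log v\<close>\<close>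

lemma bij_betw_add_mod:
  fixes c v :: nat
  shows "bij_betw (\<lambda>u. (u + c) mod v) {..<v} {..<v}"
proof -
  have "inj_on (\<lambda>u. (u + c) mod v) {..<v}"
  proof (rule inj_onI)
    fix x y assume xy: "x \<in> {..<v}" "y \<in> {..<v}" "(x + c) mod v = (y + c) mod v"
    then have "[x + c = y + c] (mod v)" by (simp add: cong_def)
    then have "[x = y] (mod v)" by (rule cong_add_rcancel_nat[THEN iffD1])
    then show "x = y" using xy by (simp add: cong_def)
  qed
  moreover have "(\<lambda>u. (u + c) mod v) ` {..<v} \<subseteq> {..<v}" by auto
  ultimately show ?thesis
    by (simp add: bij_betw_def endo_inj_surj)
qed

text \<open>Translation by \<open>c\<close> permutes the residues, which reduces the count to
  solutions of \<open>u = t\<close>.\<close>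

lemma sum_of_bool_add_mod:
  fixes c v t :: nat
  assumes "t < v"
  shows "(\<Sum>u<v. of_bool ((u + c) mod v = t)) = (1::real)"
proof -
  have "(\<Sum>u<v. of_bool ((u + c) mod v = t)) = (\<Sum>u<v. of_bool (u = t) :: real)"
    by (rule sum.reindex_bij_betw[OF bij_betw_add_mod])
  also have "\<dots> = 1" using assms by simp
  finally show ?thesis .
qed

text \<open>The entropy varies continuously from \<open>0\<close> to \<open>log v\<close> along the segment from a point mass
  to the uniform distribution.\<close>

lemma ex_distribution_with_entropy:
  fixes a :: real and v :: nat
  assumes "0 \<le> a" "a \<le> log 2 (real v)" "1 \<le> v"
  shows "\<exists>q :: nat \<Rightarrow> real. (\<forall>c. 0 \<le> q c) \<and> (\<Sum>c<v. q c) = 1 \<and>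
    - (\<Sum>c<v. q c * log 2 (q c)) = a"
proof -
  define q where "q = (\<lambda>t (c::nat). (1 - t) * of_bool (c = 0) + t / real v)"
  define g where "g = (\<lambda>t. - (\<Sum>c<v. q t c * log 2 (q t c)))"
  have nn: "0 \<le> q t c" if "t \<in> {0..1}" for t c
    using that by (auto simp: q_def)
  have cont: "continuous_on {0..1} (\<lambda>t. q t c * log 2 (q t c))" for c
    by (rule continuous_on_compose2[OF continuous_on_mult_log, of _ "\<lambda>t. q t c"])
      (use nn assms(3) in \<open>auto simp: q_def intro!: continuous_intros\<close>)
  have "continuous_on {0..1} g"
    unfolding g_def by (intro continuous_on_minus continuous_on_sum cont)
  moreover have "g 0 = 0"
    by (auto simp: g_def q_def of_bool_def intro!: sum.neutral)
  moreover have "g 1 = log 2 (real v)"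
    using assms(3) by (simp add: g_def q_def log_divide)
  ultimately obtain t where t: "t \<in> {0..1}" "g t = a"
    using IVT'[of g 0 a 1] assms by auto
  have "(\<Sum>c<v. q t c) = 1"
    using assms(3) by (simp add: q_def sum.distrib sum_distrib_left[symmetric] of_bool_def)
  then show ?thesis
    using t nn by (intro exI[of _ "q t"]) (auto simp: g_def)
qed

text \<open>Averages over sample points rather than values: \<open>m \<omega>\<close> is the mass of
  the fibre through \<open>\<omega>\<close>, constant on fibres, so grouping the points by value
  recovers the entropy.\<close>

lemma entropy2_point_measure:
  fixes w :: "'w \<Rightarrow> real"
  assumes fin: "finite \<Omega>" and w: "\<And>\<omega>. \<omega> \<in> \<Omega> \<Longrightarrow> 0 \<le> w \<omega>"
    and m: "\<And>\<omega>. \<omega> \<in> \<Omega> \<Longrightarrow> (\<Sum>\<omega>'\<in>\<Omega>. w \<omega>' * of_bool (Y \<omega>' = Y \<omega>)) = m \<omega>"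
  shows "entropy2 (point_measure \<Omega> w) Y = - (\<Sum>\<omega>\<in>\<Omega>. w \<omega> * log 2 (m \<omega>))"
proof -
  have meas: "measure (point_measure \<Omega> w) (Y -` {y} \<inter> \<Omega>) = (\<Sum>\<omega>\<in>{\<omega>\<in>\<Omega>. Y \<omega> = y}. w \<omega>)" for y
  proof -
    have "Y -` {y} \<inter> \<Omega> = {\<omega>\<in>\<Omega>. Y \<omega> = y}" by auto
    moreover have "(\<Sum>\<omega>\<in>{\<omega>\<in>\<Omega>. Y \<omega> = y}. ennreal (w \<omega>)) = ennreal (\<Sum>\<omega>\<in>{\<omega>\<in>\<Omega>. Y \<omega> = y}. w \<omega>)"
      using w by (intro sum_ennreal) auto
    moreover have "0 \<le> (\<Sum>\<omega>\<in>{\<omega>\<in>\<Omega>. Y \<omega> = y}. w \<omega>)"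
      using w by (intro sum_nonneg) auto
    ultimately show ?thesis
      using fin by (simp add: measure_def emeasure_point_measure_finite)
  qed
  have mY: "(\<Sum>\<omega>'\<in>{\<omega>'\<in>\<Omega>. Y \<omega>' = Y \<omega>}. w \<omega>') = m \<omega>" if "\<omega> \<in> \<Omega>" for \<omega>
    unfolding m[OF that, symmetric] using fin
    by (simp add: sum.inter_filter of_bool_def if_distrib cong: if_cong)
  have "entropy2 (point_measure \<Omega> w) Y = - (\<Sum>y\<in>Y ` \<Omega>. \<Sum>\<omega>\<in>{\<omega>\<in>\<Omega>. Y \<omega> = y}. w \<omega> * log 2 (m \<omega>))"
    unfolding entropy2_def space_point_measure meas sum_distrib_right using mY
    by (intro arg_cong[where f = uminus] sum.cong refl) auto
  also have "\<dots> = - (\<Sum>\<omega>\<in>\<Omega>. w \<omega> * log 2 (m \<omega>))"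
    using sum.image_gen[OF fin, of "\<lambda>\<omega>. w \<omega> * log 2 (m \<omega>)" Y] by simp
  finally show ?thesis .
qed

lemma add_mod_eq_iff:
  fixes u u' c v :: nat
  assumes "u < v" "u' < v"
  shows "(u' + c) mod v = (u + c) mod v \<longleftrightarrow> u' = u" "(c + u') mod v = (c + u) mod v \<longleftrightarrow> u' = u"
  using inj_on_eq_iff[OF bij_betw_imp_inj_on[OF bij_betw_add_mod[of c v]], of u' u] assms
  by (simp_all only: add.commute[of c] lessThan_iff)

text \<open>Single residues are padded to pairs, since all coordinates share one value type.\<close>

definition cyclic_vector :: "nat \<Rightarrow> nat \<Rightarrow> nat \<times> nat \<times> nat \<Rightarrow> nat \<times> nat" where
  "cyclic_vector v i = (\<lambda>(c, u, d).
     if i = 1 then (c, d) else if i = 2 then (u, 0)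
     else if i = 3 then ((u + c) mod v, 0) else ((u + d) mod v, 0))"

lemma entropic_if_log:
  fixes a b :: real
  assumes "0 \<le> a" "0 \<le> b" and v: "1 \<le> v" and ab: "a + b = log 2 (real v)"
  shows "entropic (face_point hatU35_1 W2_23 a b)"
proof -
  \<comment> \<open>\<open>b \<ge> 0\<close> yields \<open>a \<le> log 2 (real v)\<close>, the range
    in which \<open>C\<close> can be given entropy \<open>a\<close>.\<close>
  obtain q :: "nat \<Rightarrow> real" where q0: "\<And>c. 0 \<le> q c" and q1: "(\<Sum>c<v. q c) = 1"
    and qa: "- (\<Sum>c<v. q c * log 2 (q c)) = a"
    using ex_distribution_with_entropy[of a v] assms by auto
  define \<Omega> where "\<Omega> = {..<v} \<times> {..<v} \<times> {..<v}"
  define w where "w = (\<lambda>(c, u::nat, d::nat). q c / real v ^ 2)"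
  define M where "M = point_measure \<Omega> w"
  let ?X = "cyclic_vector v"
  have fin: "finite \<Omega>" by (simp add: \<Omega>_def)
  have w0: "0 \<le> w \<omega>" for \<omega> using q0 by (simp add: w_def case_prod_beta)
  have sumw: "(\<Sum>\<omega>\<in>\<Omega>. w \<omega> * f \<omega>) =
      (\<Sum>c<v. q c * (\<Sum>u<v. \<Sum>d<v. f (c, u, d))) / real v ^ 2" for f
    by (simp add: \<Omega>_def w_def sum.cartesian_product' sum_divide_distrib sum_distrib_left)
  have prob: "prob_space M"
    unfolding M_def
  proof (rule prob_space_point_measure[OF fin])
    have "(\<Sum>\<omega>\<in>\<Omega>. w \<omega>) = 1"
      using sumw[of "\<lambda>_. 1"] v q1 by (simp add: sum_distrib_right[symmetric] power2_eq_square)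
    then show "(\<Sum>\<omega>\<in>\<Omega>. ennreal (w \<omega>)) = 1" using w0 by (simp add: sum_ennreal)
  qed simp
  have simple: "simple_function M Y" for Y :: "nat \<times> nat \<times> nat \<Rightarrow> 'z"
    using fin by (simp add: M_def)
  \<comment> \<open>\<open>i\<close> tells whether the coordinates in \<open>A\<close> determine
    \<open>c\<close>, and \<open>j\<close> counts the further uniform residues they carry. A fibre
    has \<open>v ^ (2 - j)\<close> pairs \<open>(u', d')\<close> for each admissible
    \<open>c'\<close>, hence the entropy is \<open>i\<close> times that of \<open>C\<close> plus
    \<open>j\<close> times \<open>log 2 v\<close>. For \<open>i = 0\<close> the convention
    \<open>0 ^ 0 = 1\<close> admits every \<open>c'\<close>.\<close>
  have entropy: "joint_entropy M ?X A = real i * a + real j * (a + b)"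
    if A: "A \<subseteq> N4" and ij: "i \<le> 1" "j \<le> 2"
      and N: "\<And>c' c u d. c' < v \<Longrightarrow> c < v \<Longrightarrow> u < v \<Longrightarrow> d < v \<Longrightarrow>
        (\<Sum>u'<v. \<Sum>d'<v. of_bool (\<forall>k\<in>A. ?X k (c', u', d') = ?X k (c, u, d))) =
        (of_bool (c' = c) ^ i * real v ^ (2 - j) :: real)"
    for A i j
  proof -
    \<comment> \<open>Probability of the fibre of \<open>X\<^sub>A\<close> through \<open>\<omega>\<close>.\<close>
    let ?m = "\<lambda>\<omega>. q (fst \<omega>) ^ i / real v ^ j"
    have i: "i = 0 \<or> i = 1" using ij by auto
    have j: "real v ^ (2 - j) / real v ^ 2 = 1 / real v ^ j"
      using ij v by (simp add: power_diff)
    have m: "(\<Sum>\<omega>'\<in>\<Omega>. w \<omega>' * of_bool (subvector ?X A \<omega>' = subvector ?X A \<omega>)) = ?m \<omega>"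
      if \<omega>\<Omega>: "\<omega> \<in> \<Omega>" for \<omega>
    proof -
      obtain c u d where \<omega>: "\<omega> = (c, u, d)" and lt: "c < v" "u < v" "d < v"
        using \<omega>\<Omega> by (auto simp: \<Omega>_def)
      have "(\<Sum>\<omega>'\<in>\<Omega>. w \<omega>' * of_bool (subvector ?X A \<omega>' = subvector ?X A \<omega>)) =
          (\<Sum>c'<v. q c' * (of_bool (c' = c) ^ i * real v ^ (2 - j))) / real v ^ 2"
        unfolding sumw \<omega> subvector_eq_iff
        by (intro arg_cong2[where f = "(/)"] sum.cong refl arg_cong2[where f = "(*)"] N)
          (use lt in auto)
      also have "\<dots> = (\<Sum>c'<v. q c' * of_bool (c' = c) ^ i) * (real v ^ (2 - j) / real v ^ 2)"
        by (simp add: sum_distrib_right mult.assoc)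
      also have "(\<Sum>c'<v. q c' * of_bool (c' = c) ^ i) = q c ^ i"
        using i
      proof
        assume "i = 1"
        moreover have "(\<Sum>c'<v. q c' * of_bool (c' = c)) = (\<Sum>c'<v. if c' = c then q c' else 0)"
          by (intro sum.cong) auto
        ultimately show ?thesis using lt by simp
      qed (simp add: q1)
      finally show ?thesis by (simp add: j \<omega>)
    qed
    have t: "q c * log 2 (q c ^ i / real v ^ j) =
        real i * (q c * log 2 (q c)) - real j * log 2 (real v) * q c" for c
    proof (cases "q c = 0")
      case False
      then have "q c > 0" using q0[of c] by simp
      then show ?thesis using v by (simp add: log_divide log_nat_power algebra_simps)
    qed simp
    have "joint_entropy M ?X A = entropy2 M (subvector ?X A)"
      using A simple by (intro joint_entropy_eq_entropy2 prob) (auto simp: N4_def finite_subset)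
    also have "\<dots> = - (\<Sum>\<omega>\<in>\<Omega>. w \<omega> * log 2 (?m \<omega>))"
      unfolding M_def by (rule entropy2_point_measure[OF fin w0 m])
    also have "\<dots> = - (\<Sum>c<v. q c * log 2 (q c ^ i / real v ^ j))"
      using v unfolding sumw
      by (simp add: power2_eq_square sum_divide_distrib)
    also have "\<dots> = real i * a + real j * log 2 (real v)"
      unfolding t by (simp add: sum_subtractf sum_distrib_left[symmetric] q1 qa[symmetric])
    finally show ?thesis by (simp add: ab)
  qed
  have pos: "0 < v" using v by simp
  have K: "(\<Sum>u'<v. of_bool ((u' + x) mod v = (y + z) mod v)) = (1::real)"
    "(\<Sum>u'<v. of_bool ((x + u') mod v = (y + z) mod v)) = (1::real)" for x y z
    using sum_of_bool_add_mod[of "(y + z) mod v" v x] pos by (simp_all only: add.commute[of x] mod_less_divisor)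
  have K1: "(\<Sum>u'<v. of_bool (u' = u)) = (1::real)" if "u < v" for u
    using that by simp
  have K2: "(\<Sum>u'<v. of_bool True) = real v" by simp
  \<comment> \<open>The count factors if the fibre condition splits into one on \<open>c'\<close>,
    one on \<open>u'\<close> given \<open>c'\<close>, and one on \<open>d'\<close> given
    \<open>u'\<close>, the last two having constant numbers \<open>n\<close> and \<open>m\<close> of
    solutions.\<close>
  have entropy': "joint_entropy M ?X A = real i * a + real j * (a + b)"
    if A: "A \<subseteq> N4" and ij: "i \<le> 1" "j \<le> 2"
      and cond: "\<And>c u d c' u' d'. c < v \<Longrightarrow> u < v \<Longrightarrow> d < v \<Longrightarrow> c' < v \<Longrightarrow> u' < v \<Longrightarrow> d' < v \<Longrightarrow>
        (\<forall>k\<in>A. ?X k (c', u', d') = ?X k (c, u, d)) \<longleftrightarrow>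
        (i = 1 \<longrightarrow> c' = c) \<and> Q c u c' u' \<and> R u d u' d'"
      and m: "\<And>u d u'. u < v \<Longrightarrow> d < v \<Longrightarrow> (\<Sum>d'<v. of_bool (R u d u' d')) = m"
      and n: "\<And>c u c'. u < v \<Longrightarrow> (\<Sum>u'<v. of_bool (Q c u c' u')) = n"
      and nm: "n * m = real v ^ (2 - j)"
    for A i j Q R m n
  proof (rule entropy[OF A ij])
    fix c' c u d assume lt: "c' < v" "c < v" "u < v" "d < v"
    have "(\<Sum>u'<v. \<Sum>d'<v. of_bool (\<forall>k\<in>A. ?X k (c', u', d') = ?X k (c, u, d))) =
        (\<Sum>u'<v. \<Sum>d'<v. of_bool (i = 1 \<longrightarrow> c' = c) *
          (of_bool (Q c u c' u') * of_bool (R u d u' d') :: real))"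
      by (intro sum.cong refl, subst cond) (use lt in \<open>simp_all only: lessThan_iff of_bool_conj\<close>)
    also have "\<dots> = of_bool (i = 1 \<longrightarrow> c' = c) * (n * m)"
      by (simp only: sum_distrib_left[symmetric] sum_distrib_right[symmetric] m[OF lt(3,4)]
          n[OF lt(3)])
    also have "of_bool (i = 1 \<longrightarrow> c' = c) = (of_bool (c' = c) ^ i :: real)"
      using ij(1) by (cases i) auto
    finally show "(\<Sum>u'<v. \<Sum>d'<v. of_bool (\<forall>k\<in>A. ?X k (c', u', d') = ?X k (c, u, d))) =
        (of_bool (c' = c) ^ i * real v ^ (2 - j) :: real)" unfolding nm .
  qed
  let ?T = "\<lambda>(_::nat) (_::nat) (_::nat) (_::nat). True"
  \<comment> \<open>\<open>?Q2\<close>, \<open>?Q3\<close>, \<open>?R4\<close> say that coordinates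
    2, 3, 4 agree; \<open>?R1\<close> does so for the \<open>D\<close> part of coordinate 1.\<close>
  let ?Q2 = "\<lambda>(c::nat) (u::nat) (c'::nat) (u'::nat). u' = u"
  let ?Q3 = "\<lambda>c u c' u'. (u' + c') mod v = (u + c) mod v"
  let ?R1 = "\<lambda>(u::nat) (d::nat) (u'::nat) (d'::nat). d' = d"
  let ?R4 = "\<lambda>u d u' d'. (u' + d') mod v = (u + d) mod v"
  \<comment> \<open>When the coordinates in \<open>A\<close> determine \<open>(c, u, d)\<close>, the
    entropy is that of the whole triple, \<open>a + 2 * (a + b)\<close>.\<close>
  have full: "joint_entropy M ?X A = 3 * a + 2 * b"
    if "A \<subseteq> N4" "\<And>c u d c' u' d'. c < v \<Longrightarrow> u < v \<Longrightarrow> d < v \<Longrightarrow> c' < v \<Longrightarrow> u' < v \<Longrightarrow> d' < v \<Longrightarrow>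
        (\<forall>k\<in>A. ?X k (c', u', d') = ?X k (c, u, d)) \<longleftrightarrow> c' = c \<and> u' = u \<and> d' = d" for A
    using entropy'[of A 1 2 ?Q2 ?R1 1 1] that K1 by simp
  have je: "joint_entropy M ?X {} = 0" "joint_entropy M ?X {1} = 2 * a + b"
    "joint_entropy M ?X {2} = a + b" "joint_entropy M ?X {3} = a + b"
    "joint_entropy M ?X {4} = a + b" "joint_entropy M ?X {2, 3} = 2 * a + b"
    "joint_entropy M ?X {2, 4} = 2 * a + 2 * b" "joint_entropy M ?X {3, 4} = 2 * a + 2 * b"
    subgoal using entropy'[of "{}" 0 0 ?T ?T "real v" "real v"] by (simp add: power2_eq_square)
    subgoal using entropy'[of "{1}" 1 1 ?T ?R1 1 "real v"] K1 by (simp add: N4_def cyclic_vector_def)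
    subgoal using entropy'[of "{2}" 0 1 ?Q2 ?T "real v" 1] K1 by (simp add: N4_def cyclic_vector_def)
    subgoal using entropy'[of "{3}" 0 1 ?Q3 ?T "real v" 1, OF _ _ _ _ K2 K(1)] by (simp add: N4_def cyclic_vector_def)
    subgoal using entropy'[of "{4}" 0 1 ?T ?R4 1 "real v", OF _ _ _ _ K(2) K2] by (simp add: N4_def cyclic_vector_def)
    \<comment> \<open>Given \<open>u' = u\<close>, agreement in coordinate 3 forces
      \<open>c' = c\<close>: together coordinates 2 and 3 reveal \<open>C\<close>, so
      \<open>i = 1\<close>.\<close>
    subgoal using entropy'[of "{2, 3}" 1 1 ?Q2 ?T "real v" 1, OF _ _ _ _ K2 K1]
      by (force simp: N4_def cyclic_vector_def add_mod_eq_iff)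
    subgoal using entropy'[of "{2, 4}" 0 2 ?Q2 ?R4 1 1, OF _ _ _ _ K(2) K1] by (simp add: N4_def cyclic_vector_def)
    \<comment> \<open>Here each \<open>c'\<close> allows exactly one \<open>u'\<close>, and then one
      \<open>d'\<close>, so \<open>C\<close> stays free and \<open>i = 0\<close>.\<close>
    subgoal using entropy'[of "{3, 4}" 0 2 ?Q3 ?R4 1 1, OF _ _ _ _ K(2) K(1)] by (simp add: N4_def cyclic_vector_def)
    done
  have jf: "joint_entropy M ?X {1, 2} = 3 * a + 2 * b" "joint_entropy M ?X {1, 3} = 3 * a + 2 * b"
    "joint_entropy M ?X {1, 4} = 3 * a + 2 * b" "joint_entropy M ?X {1, 2, 3} = 3 * a + 2 * b"
    "joint_entropy M ?X {1, 2, 4} = 3 * a + 2 * b" "joint_entropy M ?X {1, 3, 4} = 3 * a + 2 * b"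
    "joint_entropy M ?X {2, 3, 4} = 3 * a + 2 * b" "joint_entropy M ?X {1, 2, 3, 4} = 3 * a + 2 * b"
    by (rule full; auto simp: N4_def cyclic_vector_def add_mod_eq_iff)+
  \<comment> \<open>Sample points are triples and values are pairs, so \<open>entropicI\<close> does
    the recoding by natural numbers.\<close>
  show ?thesis
  proof (rule entropicI[OF prob simple])
    fix A assume "A \<subseteq> N4"
    then have "A = (if 1 \<in> A then {1} else {}) \<union> (if 2 \<in> A then {2} else {}) \<union>
        (if 3 \<in> A then {3} else {}) \<union> (if 4 \<in> A then {4} else {})"
      by (auto simp: N4_def)
    then consider "A = {}" | "A = {1}" | "A = {2}" | "A = {3}" | "A = {4}"
      | "A = {1, 2}" | "A = {1, 3}" | "A = {1, 4}" | "A = {2, 3}" | "A = {2, 4}" | "A = {3, 4}"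
      | "A = {1, 2, 3}" | "A = {1, 2, 4}" | "A = {1, 3, 4}" | "A = {2, 3, 4}" | "A = {1, 2, 3, 4}"
      by (cases "1 \<in> A"; cases "2 \<in> A"; cases "3 \<in> A"; cases "4 \<in> A")
        (simp_all only: if_True if_False Un_empty_left Un_empty_right Un_insert_left)
    then show "face_point hatU35_1 W2_23 a b A = joint_entropy M ?X A"
      by cases (simp_all only: face_point_values je jf)
  qed
qed

theorem mainTheorem20:
  fixes a b :: real
  assumes "0 \<le> a" and "0 \<le> b"
  shows "entropic (face_point hatU35_1 W2_23 a b) \<longleftrightarrow>
    (\<exists>v::nat. 1 \<le> v \<and> a + b = log 2 (real v))"
  using log_if_entropic entropic_if_log[OF assms] by blast

end
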